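(* Let $A(t), B(t), C(t), Q(t)$ be smooth functions of $t$ (on an open interval) with $A(t)\neq 0$, $B(t)\neq 0$, $C(t)\neq 0$ and $Q(t)$ arbitrary. Then the variable-coefficient Gardner equation $$F\equiv u_t + A(t)\,u\,u_x + C(t)\,u^2u_x + B(t)\,u_{xxx} + Q(t)\,u = 0,\qquad u=u(x,t),$$ is nonlinearly self-adjoint, and the substitutions $v=\varphi(x,t,u)$ realizing nonlinear self-adjointness are given by $$\varphi = c_1\, e^{\int 2Q(t)\,dt}\,u + c_2\, e^{\int Q(t)\,dt},$$ with $c_1$ and $c_2$ arbitrary constants (not both zero, since $\varphi\neq 0$ is required).
   Context: Adjoint equation: for a partial differential equation $F(\mathrm{x},u,u_{(1)},\ldots,u_{(s)})=0$ with independent variables $\mathrm{x}=(x^1,\ldots,x^n)$ (here $(x,t)$) and one dependent variable $u$, where $u_{(k)}$ denotes the set of $k$-th order partial derivatives of $u$, introduce a new dependent variable $v=v(\mathrm{x})$. The adjoint equation is $F^*(\mathrm{x},u,v,u_{(1)},v_{(1)},\ldots,u_{(s)},v_{(s)})=0$ with $$F^*=\frac{\delta (vF)}{\delta u},\qquad \frac{\delta}{\delta u}=\frac{\partial}{\partial u}+\sum_{s=1}^{\infty}(-1)^s D_{i_1}\cdots D_{i_s}\frac{\partial}{\partial u_{i_1\cdots i_s}},$$ where $D_i$ denotes the total derivative with respect to $x^i$ (acting on $u$, $v$ and all their derivatives; each distinct partial derivative of $u$ is counted once in the sum). Nonlinear self-adjointness: the equation $F=0$ is nonlinearly self-adjoint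 if the equation obtained from the adjoint equation by a substitution $v=\varphi(\mathrm{x},u)$ with $\varphi(\mathrm{x},u)\neq 0$ (i.e. not identically zero) is identical with the original equation, that is, if $$F^*\big|_{v=\varphi}=\lambda(\mathrm{x},u,\ldots)\,F$$ for some differential function $\lambda=\lambda(\mathrm{x},u,\ldots)$ (a function of $\mathrm{x}$, $u$ and finitely many derivatives of $u$). Here $F^*|_{v=\varphi}$ means that $v$ and its derivatives are replaced by $\varphi$ and its corresponding total derivatives, and the identity is required to hold identically in $x$, $t$, $u$ and all derivatives of $u$, regarded as independent variables. The symbols $\int Q(t)\,dt$ and $\int 2Q(t)\,dt$ denote fixed antiderivatives of $Q$ and $2Q$. *)

theory Defs
  imports "HOL-Analysis.Analysis" "HOL-Library.Groups_Big_Fun"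
begin

text \<open>
  \<open>Ck_on k S f\<close> is meant for open \<open>S\<close>: \<open>f\<close> is k times continuously differentiable on \<open>S\<close>,
  expressed through iterated directional derivatives.
\<close>

primrec Ck_on ::
  "nat \<Rightarrow> 'a::euclidean_space set \<Rightarrow> ('a \<Rightarrow> 'b::real_normed_vector) \<Rightarrow> bool" where
  "Ck_on 0 S f \<longleftrightarrow> continuous_on S f"
| "Ck_on (Suc k) S f \<longleftrightarrow>
     (\<forall>x\<in>S. f differentiable (at x)) \<and>
     (\<forall>h. Ck_on k S (\<lambda>x. frechet_derivative f (at x) h))"

definition smooth_on ::
  "'a::euclidean_space set \<Rightarrow> ('a \<Rightarrow> 'b::real_normed_vector) \<Rightarrow> bool" where
  "smooth_on S f \<longleftrightarrow> (\<forall>k. Ck_on k S f)"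


text \<open>
  A point of the fibre of the infinite jet space of one dependent variable \<open>u\<close> of \<open>(x, t)\<close>:
  the coordinate \<open>w (i, j)\<close> stands for the derivative of \<open>u\<close> taken \<open>i\<close> times in \<open>x\<close> and
  \<open>j\<close> times in \<open>t\<close>; in particular \<open>w (0, 0)\<close> is \<open>u\<close> itself. All coordinates are independent
  variables, and each distinct partial derivative occurs exactly once.
\<close>

type_synonym jet = "nat \<times> nat \<Rightarrow> real"

text \<open>Functions of \<open>(x, t)\<close> and the jet of \<open>u\<close>, and of \<open>(x, t)\<close> and the jets of \<open>u\<close> and \<open>v\<close>.\<close>

type_synonym jfun = "real \<Rightarrow> real \<Rightarrow> jet \<Rightarrow> real"
type_synonym jfun2 = "real \<Rightarrow> real \<Rightarrow> jet \<Rightarrow> jet \<Rightarrow> real"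

definition differential_function :: "jfun \<Rightarrow> bool" where
  "differential_function f \<longleftrightarrow>
     (\<exists>N. \<forall>x t w w'. (\<forall>i j. i + j \<le> N \<longrightarrow> w (i, j) = w' (i, j)) \<longrightarrow> f x t w = f x t w')"

definition partial_u :: "nat \<times> nat \<Rightarrow> jfun2 \<Rightarrow> jfun2" where
  "partial_u k f = (\<lambda>x t u v. deriv (\<lambda>s. f x t (u(k := s)) v) (u k))"

definition partial_v :: "nat \<times> nat \<Rightarrow> jfun2 \<Rightarrow> jfun2" where
  "partial_v k f = (\<lambda>x t u v. deriv (\<lambda>s. f x t u (v(k := s))) (v k))"

text \<open>
  \<open>Sum_any\<close> sums over all indices with a nonzero summand. There are only finitely many of these,
  since the functions considered depend on finitely many jet coordinates.
\<close>

definition Dx :: "jfun2 \<Rightarrow> jfun2" where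
  "Dx f = (\<lambda>x t u v. deriv (\<lambda>s. f s t u v) x
     + Sum_any (\<lambda>(i, j). u (Suc i, j) * partial_u (i, j) f x t u v)
     + Sum_any (\<lambda>(i, j). v (Suc i, j) * partial_v (i, j) f x t u v))"

definition Dt :: "jfun2 \<Rightarrow> jfun2" where
  "Dt f = (\<lambda>x t u v. deriv (\<lambda>s. f x s u v) t
     + Sum_any (\<lambda>(i, j). u (i, Suc j) * partial_u (i, j) f x t u v)
     + Sum_any (\<lambda>(i, j). v (i, Suc j) * partial_v (i, j) f x t u v))"

text \<open>The summand with index \<open>(0, 0)\<close> is the leading term \<open>\<partial>f/\<partial>u\<close>.\<close>

definition variational_derivative_u :: "jfun2 \<Rightarrow> jfun2" where
  "variational_derivative_u f = (\<lambda>x t u v.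
     Sum_any (\<lambda>(i, j). (- 1) ^ (i + j) * (Dx ^^ i) ((Dt ^^ j) (partial_u (i, j) f)) x t u v))"

definition adjoint_eq :: "jfun \<Rightarrow> jfun2" where
  "adjoint_eq F = variational_derivative_u (\<lambda>x t u v. v (0, 0) * F x t u)"

text \<open>
  The jet obtained from \<open>v = \<phi>(x, t, u)\<close> by total differentiation. Since \<open>\<phi>\<close> does not
  involve \<open>v\<close>, the value given to the \<open>v\<close>-jet (here zero) is immaterial.
\<close>

definition substituted_jet :: "(real \<times> real \<times> real \<Rightarrow> real) \<Rightarrow> real \<Rightarrow> real \<Rightarrow> jet \<Rightarrow> jet" where
  "substituted_jet \<phi> x t u =
     (\<lambda>(i, j). (Dx ^^ i) ((Dt ^^ j) (\<lambda>x t u v. \<phi> (x, t, u (0, 0)))) x t u (\<lambda>_. 0))"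

text \<open>
  The equation \<open>F = 0\<close> is considered for all real \<open>x\<close>, for \<open>t\<close> in the interval \<open>I\<close>, and for
  arbitrary values of \<open>u\<close> and its derivatives.
\<close>

definition self_adjoint_substitution ::
  "real set \<Rightarrow> jfun \<Rightarrow> (real \<times> real \<times> real \<Rightarrow> real) \<Rightarrow> bool" where
  "self_adjoint_substitution I F \<phi> \<longleftrightarrow>
     smooth_on (UNIV \<times> I \<times> UNIV) \<phi> \<and>
     (\<exists>x. \<exists>t\<in>I. \<exists>u. \<phi> (x, t, u) \<noteq> 0) \<and>
     (\<exists>lam. differential_function lam \<and>
        (\<forall>x. \<forall>t\<in>I. \<forall>u. adjoint_eq F x t u (substituted_jet \<phi> x t u) = lam x t u * F x t u))"

definition nonlinearly_self_adjoint :: "real set \<Rightarrow> jfun \<Rightarrow> bool" where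
  "nonlinearly_self_adjoint I F \<longleftrightarrow> (\<exists>\<phi>. self_adjoint_substitution I F \<phi>)"

definition gardner ::
  "(real \<Rightarrow> real) \<Rightarrow> (real \<Rightarrow> real) \<Rightarrow> (real \<Rightarrow> real) \<Rightarrow> (real \<Rightarrow> real) \<Rightarrow> jfun" where
  "gardner A B C Q = (\<lambda>x t u.
     u (0, 1) + A t * u (0, 0) * u (1, 0) + C t * (u (0, 0))\<^sup>2 * u (1, 0)
       + B t * u (3, 0) + Q t * u (0, 0))"

end

theory Submission
  imports Defs
begin

text \<open>
  For the Gardner equation the adjoint equation is
  \<open>F\<^sup>* = - v\<^sub>t - (A u + C u\<^sup>2) v\<^sub>x - B v\<^sub>x\<^sub>x\<^sub>x + Q v\<close>: the terms with \<open>u\<^sub>x v\<close> cancel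
  (\<open>adjoint_eq_gardner\<close>). The total derivatives of \<open>\<phi>(x, t, u)\<close> are polynomials in the derivatives
  of \<open>u\<close> with partial derivatives of \<open>\<phi>\<close> as coefficients.

  Suppose \<open>F\<^sup>* = \<lambda> F\<close> after the substitution. On the zero set of \<open>F\<close>, which is the graph expressing
  \<open>u\<^sub>t\<close> through the other coordinates, the multiplier disappears whatever \<open>\<lambda>\<close> is, and a polynomial
  identity in the free variables \<open>u\<^sub>x\<close> and \<open>u\<^sub>x\<^sub>x\<close> remains (\<open>determining_equation\<close>). Since \<open>B \<noteq> 0\<close>,
  the coefficient of \<open>u\<^sub>x u\<^sub>x\<^sub>x\<close> gives \<open>\<phi>\<^sub>u\<^sub>u = 0\<close> and that of \<open>u\<^sub>x\<^sub>x\<close> gives \<open>\<phi>\<^sub>x\<^sub>u = 0\<close>. Hence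
  \<open>\<phi> = a(t) u + b(x, t)\<close>, and the rest of the identity is quadratic in \<open>u\<close> with leading coefficient
  \<open>- C b\<^sub>x\<close>. As \<open>C \<noteq> 0\<close>, \<open>b\<close> depends on \<open>t\<close> only, and what is left are the linear equations
  \<open>a' = 2 Q a\<close> and \<open>b' = Q b\<close>. Their solutions on an interval are the multiples of
  \<open>exp (\<integral> 2 Q)\<close> and \<open>exp (\<integral> Q)\<close> (\<open>self_adjoint_substitution_imp_exponential_form\<close>).

  Conversely every such \<open>\<phi>\<close> satisfies the identity with \<open>\<lambda> = - \<phi>\<^sub>u = - c\<^sub>1 exp (\<integral> 2 Q)\<close>; it is smooth
  because the derivative of \<open>exp (\<integral> Q)\<close> is \<open>Q exp (\<integral> Q)\<close>, so that each order of
  differentiability yields the next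
  (\<open>exponential_form_imp_self_adjoint_substitution\<close>).
\<close>

section \<open>Total derivatives of functions of finitely many jet coordinates\<close>

lemma Dx_finite_support:
  assumes "finite K" and "finite L"
    and "\<And>k. k \<notin> K \<Longrightarrow> partial_u k f x t u v = 0"
    and "\<And>k. k \<notin> L \<Longrightarrow> partial_v k f x t u v = 0"
  shows "Dx f x t u v = deriv (\<lambda>s. f s t u v) x
    + (\<Sum>(i, j)\<in>K. u (Suc i, j) * partial_u (i, j) f x t u v)
    + (\<Sum>(i, j)\<in>L. v (Suc i, j) * partial_v (i, j) f x t u v)"
proof -
  have "Sum_any (\<lambda>(i, j). u (Suc i, j) * partial_u (i, j) f x t u v)
      = (\<Sum>(i, j)\<in>K. u (Suc i, j) * partial_u (i, j) f x t u v)"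
    by (rule Sum_any.expand_superset[OF assms(1)]) (use assms(3) in force)
  moreover have "Sum_any (\<lambda>(i, j). v (Suc i, j) * partial_v (i, j) f x t u v)
      = (\<Sum>(i, j)\<in>L. v (Suc i, j) * partial_v (i, j) f x t u v)"
    by (rule Sum_any.expand_superset[OF assms(2)]) (use assms(4) in force)
  ultimately show ?thesis by (simp add: Dx_def)
qed

lemma Dt_finite_support:
  assumes "finite K" and "finite L"
    and "\<And>k. k \<notin> K \<Longrightarrow> partial_u k f x t u v = 0"
    and "\<And>k. k \<notin> L \<Longrightarrow> partial_v k f x t u v = 0"
  shows "Dt f x t u v = deriv (\<lambda>s. f x s u v) t
    + (\<Sum>(i, j)\<in>K. u (i, Suc j) * partial_u (i, j) f x t u v)
    + (\<Sum>(i, j)\<in>L. v (i, Suc j) * partial_v (i, j) f x t u v)"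
proof -
  have "Sum_any (\<lambda>(i, j). u (i, Suc j) * partial_u (i, j) f x t u v)
      = (\<Sum>(i, j)\<in>K. u (i, Suc j) * partial_u (i, j) f x t u v)"
    by (rule Sum_any.expand_superset[OF assms(1)]) (use assms(3) in force)
  moreover have "Sum_any (\<lambda>(i, j). v (i, Suc j) * partial_v (i, j) f x t u v)
      = (\<Sum>(i, j)\<in>L. v (i, Suc j) * partial_v (i, j) f x t u v)"
    by (rule Sum_any.expand_superset[OF assms(2)]) (use assms(4) in force)
  ultimately show ?thesis by (simp add: Dt_def)
qed

lemma Dx_zero: "Dx (\<lambda>x t u v. 0) = (\<lambda>x t u v. 0)"
  by (intro ext, subst Dx_finite_support[of "{}" "{}"]) (auto simp: partial_u_def partial_v_def)

lemma Dt_zero: "Dt (\<lambda>x t u v. 0) = (\<lambda>x t u v. 0)"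
  by (intro ext, subst Dt_finite_support[of "{}" "{}"]) (auto simp: partial_u_def partial_v_def)

lemma funpow_Dx_zero: "(Dx ^^ i) (\<lambda>x t u v. 0) = (\<lambda>x t u v. 0)"
  by (induction i) (auto simp: Dx_zero)

lemma funpow_Dt_zero: "(Dt ^^ i) (\<lambda>x t u v. 0) = (\<lambda>x t u v. 0)"
  by (induction i) (auto simp: Dt_zero)

text \<open>
  The total derivative \<open>Dx\<close> never varies \<open>t\<close>, so the explicit form \<open>G\<close> of \<open>f\<close> is only required at the
  given \<open>t\<close>. This matters when \<open>Dx\<close> is iterated on \<open>\<phi>(x, t, u)\<close>, whose derivatives are controlled
  only for \<open>t\<close> in the interval.
\<close>

lemma Dx_function_of_u_ux_uxx:
  assumes "\<And>x u v. f x t u v = G x (u (0, 0)) (u (1, 0)) (u (2, 0))"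
    and "((\<lambda>s. G s (u (0, 0)) (u (1, 0)) (u (2, 0))) has_real_derivative gx) (at x)"
    and "((\<lambda>s. G x s (u (1, 0)) (u (2, 0))) has_real_derivative g0) (at (u (0, 0)))"
    and "((\<lambda>s. G x (u (0, 0)) s (u (2, 0))) has_real_derivative g1) (at (u (1, 0)))"
    and "((\<lambda>s. G x (u (0, 0)) (u (1, 0)) s) has_real_derivative g2) (at (u (2, 0)))"
  shows "Dx f x t u v = gx + u (1, 0) * g0 + u (2, 0) * g1 + u (3, 0) * g2"
proof -
  have "Dx f x t u v = deriv (\<lambda>s. f s t u v) x
    + (\<Sum>(i, j)\<in>{(0, 0), (1, 0), (2, 0)}. u (Suc i, j) * partial_u (i, j) f x t u v)
    + (\<Sum>(i, j)\<in>{}. v (Suc i, j) * partial_v (i, j) f x t u v)"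
  proof (rule Dx_finite_support)
    fix k :: "nat \<times> nat" assume "k \<notin> {(0, 0), (1, 0), (2, 0)}"
    then have "(0, 0) \<noteq> k" "(1, 0) \<noteq> k" "(2, 0) \<noteq> k" by auto
    then show "partial_u k f x t u v = 0" by (simp add: partial_u_def assms(1))
  qed (simp_all add: partial_v_def assms(1))
  then show ?thesis
    using assms(2-)[THEN DERIV_imp_deriv]
    by (simp add: partial_u_def assms(1) numeral_2_eq_2 numeral_3_eq_3)
qed

lemma Dt_function_of_u:
  assumes "\<And>x t u v. f x t u v = G x t (u (0, 0))"
    and "((\<lambda>s. G x s (u (0, 0))) has_real_derivative gt) (at t)"
    and "((\<lambda>s. G x t s) has_real_derivative g0) (at (u (0, 0)))"
  shows "Dt f x t u v = gt + u (0, 1) * g0"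
proof -
  have "Dt f x t u v = deriv (\<lambda>s. f x s u v) t
    + (\<Sum>(i, j)\<in>{(0, 0)}. u (i, Suc j) * partial_u (i, j) f x t u v)
    + (\<Sum>(i, j)\<in>{}. v (i, Suc j) * partial_v (i, j) f x t u v)"
    by (rule Dt_finite_support) (auto simp: partial_u_def partial_v_def assms(1))
  then show ?thesis
    using assms(2-)[THEN DERIV_imp_deriv] by (simp add: partial_u_def assms(1))
qed

lemma Dx_v_times_function_of_u:
  assumes "(g t has_real_derivative g') (at (u (0, 0)))"
  shows "Dx (\<lambda>x t u v. v (i, j) * g t (u (0, 0))) x t u v
    = v (Suc i, j) * g t (u (0, 0)) + v (i, j) * u (1, 0) * g'"
proof -
  let ?f = "\<lambda>x t u v. v (i, j) * g t (u (0, 0)) :: real"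
  have "Dx ?f x t u v = deriv (\<lambda>s. ?f s t u v) x
    + (\<Sum>(i, j)\<in>{(0, 0)}. u (Suc i, j) * partial_u (i, j) ?f x t u v)
    + (\<Sum>(i, j)\<in>{(i, j)}. v (Suc i, j) * partial_v (i, j) ?f x t u v)"
    by (rule Dx_finite_support) (auto simp: partial_u_def partial_v_def)
  moreover have "partial_u (0, 0) ?f x t u v = v (i, j) * g'"
    unfolding partial_u_def
    by (rule DERIV_imp_deriv) (auto intro!: derivative_eq_intros assms)
  moreover have "partial_v (i, j) ?f x t u v = g t (u (0, 0))"
    unfolding partial_v_def
    by (rule DERIV_imp_deriv) (auto intro!: derivative_eq_intros)
  ultimately show ?thesis by simp
qed

lemma Dt_v: "Dt (\<lambda>x t u v. v (0, 0)) x t u v = v (0, 1)"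
proof -
  let ?f = "\<lambda>x t u v. v (0, 0) :: real"
  have "Dt ?f x t u v = deriv (\<lambda>s. ?f x s u v) t
    + (\<Sum>(i, j)\<in>{}. u (i, Suc j) * partial_u (i, j) ?f x t u v)
    + (\<Sum>(i, j)\<in>{(0, 0)}. v (i, Suc j) * partial_v (i, j) ?f x t u v)"
    by (rule Dt_finite_support) (auto simp: partial_u_def partial_v_def)
  then show ?thesis by (simp add: partial_v_def)
qed

section \<open>The adjoint of the Gardner equation\<close>

text \<open>
  Only the four coordinates \<open>u\<close>, \<open>u\<^sub>x\<close>, \<open>u\<^sub>t\<close>, \<open>u\<^sub>x\<^sub>x\<^sub>x\<close> enter \<open>v F\<close>. The contribution
  \<open>v (A u\<^sub>x + 2 C u u\<^sub>x)\<close> of \<open>\<partial>/\<partial>u\<close> cancels against \<open>v D\<^sub>x (A u + C u\<^sup>2)\<close>, because the nonlinear terms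
  of \<open>F\<close> form a total \<open>x\<close>-derivative; the coefficients depend on \<open>t\<close> alone, so no derivative of them
  appears.
\<close>

lemma adjoint_eq_gardner:
  "adjoint_eq (gardner A B C Q) x t u v =
     - v (0, 1) - (A t * u (0, 0) + C t * (u (0, 0))\<^sup>2) * v (1, 0) - B t * v (3, 0) + Q t * v (0, 0)"
proof -
  define L :: jfun2 where "L = (\<lambda>x t u v. v (0, 0) * gardner A B C Q x t u)"
  have L00: "partial_u (0, 0) L x t u v
      = v (0, 0) * (A t * u (1, 0) + 2 * C t * u (0, 0) * u (1, 0) + Q t)"
    unfolding partial_u_def L_def gardner_def
    by (rule DERIV_imp_deriv) (auto intro!: derivative_eq_intros simp: algebra_simps)
  have L01: "partial_u (0, 1) L = (\<lambda>x t u v. v (0, 0))"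
    unfolding partial_u_def L_def gardner_def
    by (intro ext DERIV_imp_deriv) (auto intro!: derivative_eq_intros)
  have L10: "partial_u (1, 0) L
      = (\<lambda>x t u v. v (0, 0) * (A t * u (0, 0) + C t * (u (0, 0))\<^sup>2))"
    unfolding partial_u_def L_def gardner_def
    by (intro ext DERIV_imp_deriv) (auto intro!: derivative_eq_intros)
  have L30: "partial_u (3, 0) L = (\<lambda>x t u v. v (0, 0) * B t)"
    unfolding partial_u_def L_def gardner_def
    by (intro ext DERIV_imp_deriv) (auto intro!: derivative_eq_intros)
  have L_other: "partial_u k L = (\<lambda>x t u v. 0)" if "k \<notin> {(0, 0), (0, 1), (1, 0), (3, 0)}" for k
  proof -
    from that have "(0, 0) \<noteq> k" "(0, 1) \<noteq> k" "(1, 0) \<noteq> k" "(3, 0) \<noteq> k" by auto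
    then show ?thesis unfolding partial_u_def L_def gardner_def by simp
  qed
  have Dx_v: "Dx (\<lambda>x t u v. v (i, 0) * B t) = (\<lambda>x t u v. v (Suc i, 0) * B t)" for i
    by (intro ext, subst Dx_v_times_function_of_u[where g = "\<lambda>t s. B t" and g' = 0]) auto
  have Dx_L10: "Dx (\<lambda>x t u v. v (0, 0) * (A t * u (0, 0) + C t * (u (0, 0))\<^sup>2)) x t u v
      = v (Suc 0, 0) * (A t * u (0, 0) + C t * (u (0, 0))\<^sup>2)
        + v (0, 0) * u (1, 0) * (A t + 2 * C t * u (0, 0))"
    by (rule Dx_v_times_function_of_u) (auto intro!: derivative_eq_intros)
  have "adjoint_eq (gardner A B C Q) x t u v
      = Sum_any (\<lambda>(i, j). (- 1) ^ (i + j) * (Dx ^^ i) ((Dt ^^ j) (partial_u (i, j) L)) x t u v)"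
    by (simp add: adjoint_eq_def variational_derivative_u_def L_def)
  also have "\<dots> = (\<Sum>(i, j)\<in>{(0, 0), (0, 1), (1, 0), (3, 0)}.
      (- 1) ^ (i + j) * (Dx ^^ i) ((Dt ^^ j) (partial_u (i, j) L)) x t u v)"
  proof (rule Sum_any.expand_superset)
    show "{k. (case k of (i, j) \<Rightarrow>
        (- 1) ^ (i + j) * (Dx ^^ i) ((Dt ^^ j) (partial_u (i, j) L)) x t u v) \<noteq> 0}
        \<subseteq> {(0, 0), (0, 1), (1, 0), (3, 0)}"
    proof (rule subsetI, rule ccontr)
      fix k assume *: "k \<in> {k. (case k of (i, j) \<Rightarrow>
        (- 1) ^ (i + j) * (Dx ^^ i) ((Dt ^^ j) (partial_u (i, j) L)) x t u v) \<noteq> 0}"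
        and "k \<notin> {(0, 0), (0, 1), (1, 0), (3, 0)}"
      from this(2) have "partial_u k L = (\<lambda>x t u v. 0)" by (rule L_other)
      with * show False by (cases k) (simp add: funpow_Dx_zero funpow_Dt_zero)
    qed
  qed simp
  also have "\<dots> = partial_u (0, 0) L x t u v - Dt (partial_u (0, 1) L) x t u v
      - Dx (partial_u (1, 0) L) x t u v - Dx (Dx (Dx (partial_u (3, 0) L))) x t u v"
    by (simp add: numeral_3_eq_3)
  also have "\<dots> = - v (0, 1) - (A t * u (0, 0) + C t * (u (0, 0))\<^sup>2) * v (1, 0)
      - B t * v (3, 0) + Q t * v (0, 0)"
    unfolding L00 L01 L10 L30 Dt_v Dx_L10 Dx_v
    by (simp add: algebra_simps numeral_3_eq_3)
  finally show ?thesis .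
qed

section \<open>Closure properties of k-fold differentiability\<close>

lemma Ck_on_cong:
  assumes "open S" and "\<And>x. x \<in> S \<Longrightarrow> f x = g x" and "Ck_on k S f"
  shows "Ck_on k S g"
  using assms(2,3)
proof (induction k arbitrary: f g)
  case 0
  then show ?case by (simp cong: continuous_on_cong)
next
  case (Suc k)
  have deriv: "(g has_derivative frechet_derivative f (at x)) (at x)" if "x \<in> S" for x
  proof (rule has_derivative_transform_within_open[OF _ \<open>open S\<close> that])
    show "(f has_derivative frechet_derivative f (at x)) (at x)"
      using Suc.prems that by (auto simp: frechet_derivative_works)
  qed (use Suc.prems in auto)
  have "Ck_on k S (\<lambda>x. frechet_derivative g (at x) h)" for h
  proof (rule Suc.IH)
    show "frechet_derivative f (at x) h = frechet_derivative g (at x) h" if "x \<in> S" for x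
      using frechet_derivative_at[OF deriv[OF that]] by simp
    show "Ck_on k S (\<lambda>x. frechet_derivative f (at x) h)"
      using Suc.prems(2) by simp
  qed
  then show ?case using deriv by (auto simp: differentiable_def)
qed

lemma Ck_on_SucI:
  assumes "open S" and "\<And>x. x \<in> S \<Longrightarrow> (f has_derivative f' x) (at x)"
    and "\<And>h. Ck_on k S (\<lambda>x. f' x h)"
  shows "Ck_on (Suc k) S f"
proof -
  have "Ck_on k S (\<lambda>x. frechet_derivative f (at x) h)" for h
    using assms(2)[THEN frechet_derivative_at]
    by (intro Ck_on_cong[OF assms(1) _ assms(3)[of h]]) auto
  then show ?thesis using assms(2) by (auto simp: differentiable_def)
qed

lemma Ck_on_SucD:
  assumes "Ck_on (Suc k) S f" and "x \<in> S"
  shows "(f has_derivative frechet_derivative f (at x)) (at x)"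
  using assms by (auto simp: frechet_derivative_works)

lemma Ck_on_Suc_imp_Ck_on: "Ck_on (Suc k) S f \<Longrightarrow> Ck_on k S f"
proof (induction k arbitrary: f)
  case 0
  then show ?case
    by (auto intro!: continuous_at_imp_continuous_on differentiable_imp_continuous_within)
next
  case (Suc k)
  then show ?case by (metis Ck_on.simps(2))
qed

lemma Ck_on_const: "Ck_on k S (\<lambda>x. c)"
  by (induction k arbitrary: c) auto

lemma Ck_on_add:
  assumes "open S" and "Ck_on k S f" and "Ck_on k S g"
  shows "Ck_on k S (\<lambda>x. f x + g x)"
  using assms(2,3)
proof (induction k arbitrary: f g)
  case 0
  then show ?case by (auto intro: continuous_on_add)
next
  case (Suc k)
  show ?case
  proof (rule Ck_on_SucI[OF assms(1)])
    fix x assume "x \<in> S"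
    show "((\<lambda>x. f x + g x) has_derivative
        (\<lambda>h. frechet_derivative f (at x) h + frechet_derivative g (at x) h)) (at x)"
      by (intro has_derivative_add Ck_on_SucD[OF Suc.prems(1) \<open>x \<in> S\<close>]
          Ck_on_SucD[OF Suc.prems(2) \<open>x \<in> S\<close>])
  next
    fix h show "Ck_on k S (\<lambda>x. frechet_derivative f (at x) h + frechet_derivative g (at x) h)"
      using Suc.prems by (intro Suc.IH) auto
  qed
qed

lemma Ck_on_mult:
  fixes f g :: "'a::euclidean_space \<Rightarrow> real"
  assumes "open S" and "Ck_on k S f" and "Ck_on k S g"
  shows "Ck_on k S (\<lambda>x. f x * g x)"
  using assms(2,3)
proof (induction k arbitrary: f g)
  case 0
  then show ?case by (auto intro: continuous_on_mult)
next
  case (Suc k)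
  show ?case
  proof (rule Ck_on_SucI[OF assms(1)])
    fix x assume "x \<in> S"
    show "((\<lambda>x. f x * g x) has_derivative
        (\<lambda>h. f x * frechet_derivative g (at x) h + frechet_derivative f (at x) h * g x)) (at x)"
      by (intro has_derivative_mult Ck_on_SucD[OF Suc.prems(1) \<open>x \<in> S\<close>]
          Ck_on_SucD[OF Suc.prems(2) \<open>x \<in> S\<close>])
  next
    fix h show "Ck_on k S
        (\<lambda>x. f x * frechet_derivative g (at x) h + frechet_derivative f (at x) h * g x)"
      using Suc.prems Suc.prems[THEN Ck_on_Suc_imp_Ck_on]
      by (intro Ck_on_add assms(1) Suc.IH) simp_all
  qed
qed

lemma Ck_on_compose_linear:
  assumes "bounded_linear L" and "open T" and "open S" and "L ` T \<subseteq> S" and "Ck_on k S f"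
  shows "Ck_on k T (\<lambda>x. f (L x))"
  using assms(5)
proof (induction k arbitrary: f)
  case 0
  then show ?case
    using continuous_on_compose2[OF _ linear_continuous_on[OF assms(1)] assms(4)] by simp
next
  case (Suc k)
  show ?case
  proof (rule Ck_on_SucI[OF assms(2)])
    fix x assume "x \<in> T"
    with assms(4) have "L x \<in> S" by auto
    from has_derivative_compose[OF bounded_linear_imp_has_derivative[OF assms(1)]
        Ck_on_SucD[OF Suc.prems this]]
    show "((\<lambda>x. f (L x)) has_derivative (\<lambda>h. frechet_derivative f (at (L x)) (L h))) (at x)" .
  next
    fix h show "Ck_on k T (\<lambda>x. frechet_derivative f (at (L x)) (L h))"
      using Suc.prems by (intro Suc.IH) auto
  qed
qed

lemma Ck_on_linear:
  assumes "bounded_linear L" "open S" shows "Ck_on k S L"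
proof (cases k)
  case 0
  then show ?thesis using linear_continuous_on[OF assms(1)] by simp
next
  case (Suc m)
  show ?thesis unfolding Suc
    by (rule Ck_on_SucI[OF assms(2)])
      (auto intro: bounded_linear_imp_has_derivative assms(1) Ck_on_const)
qed

text \<open>
  Induction on the order: the derivative of \<open>exp (r t)\<close> is \<open>q t * exp (r t)\<close>, which is as often
  differentiable as the exponential is already known to be.
\<close>

lemma smooth_on_exp_antiderivative:
  fixes q r :: "real \<Rightarrow> real"
  assumes "open I" and "smooth_on I q"
    and "\<And>t. t \<in> I \<Longrightarrow> (r has_real_derivative q t) (at t)"
  shows "smooth_on I (\<lambda>t. exp (r t))"
  unfolding smooth_on_def
proof
  fix k show "Ck_on k I (\<lambda>t. exp (r t))"
  proof (induction k)
    case 0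
    have "continuous_on I r"
      using assms(3) by (intro continuous_at_imp_continuous_on ballI DERIV_isCont)
    then show ?case by (auto intro: continuous_on_exp)
  next
    case (Suc k)
    show ?case
    proof (rule Ck_on_SucI[OF assms(1)])
      fix t assume "t \<in> I"
      from DERIV_fun_exp[OF assms(3)[OF this]]
      show "((\<lambda>t. exp (r t)) has_derivative (\<lambda>h. exp (r t) * q t * h)) (at t)"
        by (simp add: has_field_derivative_def)
    next
      fix h show "Ck_on k I (\<lambda>t. exp (r t) * q t * h)"
        using assms(2) by (intro Ck_on_mult Suc assms(1) Ck_on_const) (auto simp: smooth_on_def)
    qed
  qed
qed

lemma smooth_on_frechet_derivative:
  "smooth_on S f \<Longrightarrow> smooth_on S (\<lambda>p. frechet_derivative f (at p) h)"
  unfolding smooth_on_def by (metis Ck_on.simps(2))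

lemma smooth_on_has_derivative:
  "smooth_on S f \<Longrightarrow> p \<in> S \<Longrightarrow> (f has_derivative frechet_derivative f (at p)) (at p)"
  unfolding smooth_on_def by (blast intro: Ck_on_SucD)

section \<open>Partial derivatives of the substitution and its jet\<close>

definition d_x :: "(real \<times> real \<times> real \<Rightarrow> real) \<Rightarrow> real \<times> real \<times> real \<Rightarrow> real" where
  "d_x f = (\<lambda>p. frechet_derivative f (at p) (1, 0, 0))"

definition d_t :: "(real \<times> real \<times> real \<Rightarrow> real) \<Rightarrow> real \<times> real \<times> real \<Rightarrow> real" where
  "d_t f = (\<lambda>p. frechet_derivative f (at p) (0, 1, 0))"

definition d_u :: "(real \<times> real \<times> real \<Rightarrow> real) \<Rightarrow> real \<times> real \<times> real \<Rightarrow> real" where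
  "d_u f = (\<lambda>p. frechet_derivative f (at p) (0, 0, 1))"

lemma smooth_on_d_x: "smooth_on S f \<Longrightarrow> smooth_on S (d_x f)"
  and smooth_on_d_u: "smooth_on S f \<Longrightarrow> smooth_on S (d_u f)"
  unfolding d_x_def d_u_def by (auto intro: smooth_on_frechet_derivative)

lemma has_real_derivative_along_line:
  fixes f :: "'a::real_normed_vector \<Rightarrow> real"
  assumes "(f has_derivative f') (at (c s))"
    and "(c has_derivative (\<lambda>r. r *\<^sub>R h)) (at s)"
  shows "((\<lambda>s. f (c s)) has_real_derivative f' h) (at s)"
proof -
  have "linear f'" using assms(1) by (rule has_derivative_linear)
  with has_derivative_compose[OF assms(2) assms(1)] show ?thesis
    by (simp add: has_field_derivative_def linear_scale mult.commute[of _ "f' h"] mult_commute_abs)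
qed

lemma
  assumes "smooth_on (UNIV \<times> I \<times> UNIV) f" and "t \<in> I"
  shows has_derivative_d_x: "((\<lambda>s. f (s, t, y)) has_real_derivative d_x f (x, t, y)) (at x)"
    and has_derivative_d_t: "((\<lambda>s. f (x, s, y)) has_real_derivative d_t f (x, t, y)) (at t)"
    and has_derivative_d_u: "((\<lambda>s. f (x, t, s)) has_real_derivative d_u f (x, t, y)) (at y)"
proof -
  have f: "(f has_derivative frechet_derivative f (at (x, t, y))) (at (x, t, y))"
    using assms by (intro smooth_on_has_derivative) auto
  show "((\<lambda>s. f (s, t, y)) has_real_derivative d_x f (x, t, y)) (at x)"
    unfolding d_x_def by (rule has_real_derivative_along_line[where c = "\<lambda>s. (s, t, y)", OF f])
      (auto intro!: derivative_eq_intros simp: zero_prod_def)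
  show "((\<lambda>s. f (x, s, y)) has_real_derivative d_t f (x, t, y)) (at t)"
    unfolding d_t_def by (rule has_real_derivative_along_line[where c = "\<lambda>s. (x, s, y)", OF f])
      (auto intro!: derivative_eq_intros simp: zero_prod_def)
  show "((\<lambda>s. f (x, t, s)) has_real_derivative d_u f (x, t, y)) (at y)"
    unfolding d_u_def by (rule has_real_derivative_along_line[where c = "\<lambda>s. (x, t, s)", OF f])
      (auto intro!: derivative_eq_intros simp: zero_prod_def)
qed

lemma
  assumes "smooth_on (UNIV \<times> I \<times> UNIV) f" and "t \<in> I"
  shows d_x_eq_0: "(\<And>s. f (s, t, y) = c) \<Longrightarrow> d_x f (x, t, y) = 0"
    and d_u_eq_0: "(\<And>s. f (x, t, s) = c) \<Longrightarrow> d_u f (x, t, y) = 0"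
  using has_derivative_d_x[OF assms, of y x] has_derivative_d_u[OF assms, of x y]
  by (simp_all add: DERIV_unique)

text \<open>
  The part of the total derivative \<open>D\<^sub>x\<^sup>3 \<phi>\<close> that remains after splitting off \<open>u\<^sub>x\<^sub>x\<^sub>x \<phi>\<^sub>u\<close>, at the point
  \<open>z = (x, t, u)\<close> with \<open>p = u\<^sub>x\<close> and \<open>q = u\<^sub>x\<^sub>x\<close>. Mixed partial derivatives are kept in the order in
  which they arise.
\<close>

definition lower_order_Dx3 ::
  "(real \<times> real \<times> real \<Rightarrow> real) \<Rightarrow> real \<times> real \<times> real \<Rightarrow> real \<Rightarrow> real \<Rightarrow> real" where
  "lower_order_Dx3 \<phi> z p q = d_x (d_x (d_x \<phi>)) z
      + p * (d_x (d_u (d_x \<phi>)) z + d_x (d_x (d_u \<phi>)) z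
          + d_u (d_x (d_x \<phi>)) z)
      + p\<^sup>2 * (d_x (d_u (d_u \<phi>)) z + d_u (d_u (d_x \<phi>)) z
          + d_u (d_x (d_u \<phi>)) z)
      + p ^ 3 * d_u (d_u (d_u \<phi>)) z
      + q * (2 * d_x (d_u \<phi>) z + d_u (d_x \<phi>) z)
      + 3 * p * q * d_u (d_u \<phi>) z"

lemma substituted_jet_00: "substituted_jet \<phi> x t u (0, 0) = \<phi> (x, t, u (0, 0))"
  by (simp add: substituted_jet_def)

lemma
  assumes "smooth_on (UNIV \<times> I \<times> UNIV) \<phi>" and "t \<in> I"
  shows substituted_jet_01: "substituted_jet \<phi> x t u (0, 1)
      = d_t \<phi> (x, t, u (0, 0)) + u (0, 1) * d_u \<phi> (x, t, u (0, 0))"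
    and substituted_jet_10: "substituted_jet \<phi> x t u (1, 0)
      = d_x \<phi> (x, t, u (0, 0)) + u (1, 0) * d_u \<phi> (x, t, u (0, 0))"
    and substituted_jet_30: "substituted_jet \<phi> x t u (3, 0)
      = lower_order_Dx3 \<phi> (x, t, u (0, 0)) (u (1, 0)) (u (2, 0))
        + u (3, 0) * d_u \<phi> (x, t, u (0, 0))"
proof -
  note smooth_intros = smooth_on_d_x smooth_on_d_u assms(1)
  note d_intros = has_derivative_d_x[OF _ assms(2)] has_derivative_d_u[OF _ assms(2)] smooth_intros
  define f :: jfun2 where "f = (\<lambda>x t u v. \<phi> (x, t, u (0, 0)))"
  have "Dt f x t u (\<lambda>_. 0) = d_t \<phi> (x, t, u (0, 0)) + u (0, 1) * d_u \<phi> (x, t, u (0, 0))"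
    by (rule Dt_function_of_u[where G = "\<lambda>x t y. \<phi> (x, t, y)"])
      (auto simp: f_def intro: has_derivative_d_t[OF assms] has_derivative_d_u[OF assms])
  then show "substituted_jet \<phi> x t u (0, 1)
      = d_t \<phi> (x, t, u (0, 0)) + u (0, 1) * d_u \<phi> (x, t, u (0, 0))"
    by (simp add: substituted_jet_def f_def)
  have D1: "Dx f x t u v = d_x \<phi> (x, t, u (0, 0)) + u (1, 0) * d_u \<phi> (x, t, u (0, 0))" for x u v
    by (subst Dx_function_of_u_ux_uxx[where G = "\<lambda>x y p q. \<phi> (x, t, y)" and f = f])
      (auto simp: f_def intro!: derivative_eq_intros d_intros)
  then show "substituted_jet \<phi> x t u (1, 0)
      = d_x \<phi> (x, t, u (0, 0)) + u (1, 0) * d_u \<phi> (x, t, u (0, 0))"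
    by (simp add: substituted_jet_def f_def)
  have D2: "Dx (Dx f) x t u v = d_x (d_x \<phi>) (x, t, u (0, 0))
      + u (1, 0) * (d_u (d_x \<phi>) (x, t, u (0, 0)) + d_x (d_u \<phi>) (x, t, u (0, 0)))
      + (u (1, 0))\<^sup>2 * d_u (d_u \<phi>) (x, t, u (0, 0)) + u (2, 0) * d_u \<phi> (x, t, u (0, 0))" for x u v
    by (subst Dx_function_of_u_ux_uxx[where f = "Dx f" and
          G = "\<lambda>x y p q. d_x \<phi> (x, t, y) + p * d_u \<phi> (x, t, y)"], rule D1,
        (rule derivative_eq_intros d_intros refl)+) (simp add: algebra_simps power2_eq_square)
  have D3: "Dx (Dx (Dx f)) x t u v = lower_order_Dx3 \<phi> (x, t, u (0, 0)) (u (1, 0)) (u (2, 0))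
        + u (3, 0) * d_u \<phi> (x, t, u (0, 0))" for x u v
    by (subst Dx_function_of_u_ux_uxx[where f = "Dx (Dx f)" and
          G = "\<lambda>x y p q. d_x (d_x \<phi>) (x, t, y)
            + p * (d_u (d_x \<phi>) (x, t, y) + d_x (d_u \<phi>) (x, t, y))
            + p\<^sup>2 * d_u (d_u \<phi>) (x, t, y) + q * d_u \<phi> (x, t, y)"], rule D2,
        (rule derivative_eq_intros d_intros refl)+)
      (simp add: lower_order_Dx3_def algebra_simps power2_eq_square power3_eq_cube)
  then show "substituted_jet \<phi> x t u (3, 0) = lower_order_Dx3 \<phi> (x, t, u (0, 0)) (u (1, 0)) (u (2, 0))
        + u (3, 0) * d_u \<phi> (x, t, u (0, 0))"
    by (simp add: substituted_jet_def f_def numeral_3_eq_3)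
qed

section \<open>The determining equations\<close>

lemma linear_ode_solution:
  fixes a q r :: "real \<Rightarrow> real"
  assumes "convex I"
    and "\<And>t. t \<in> I \<Longrightarrow> (a has_real_derivative q t * a t) (at t)"
    and "\<And>t. t \<in> I \<Longrightarrow> (r has_real_derivative q t) (at t)"
  shows "\<exists>c. \<forall>t\<in>I. a t = c * exp (r t)"
proof -
  have "((\<lambda>t. a t * exp (- r t)) has_real_derivative 0) (at t within I)" if "t \<in> I" for t
    by (rule derivative_eq_intros assms(2)[OF that, THEN has_field_derivative_at_within]
        assms(3)[OF that, THEN has_field_derivative_at_within] refl)+ (simp add: algebra_simps)
  from has_field_derivative_zero_constant[OF assms(1) this]
  obtain c where "\<And>t. t \<in> I \<Longrightarrow> a t * exp (- r t) = c" by blast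
  then have "\<forall>t\<in>I. a t = c * exp (r t)" by (auto simp: exp_minus field_simps)
  then show ?thesis ..
qed

text \<open>
  Choosing \<open>u\<^sub>x\<^sub>x\<^sub>x = 0\<close> and solving \<open>F = 0\<close> for \<open>u\<^sub>t\<close> gives a jet at which the right-hand side
  vanishes for every multiplier \<open>lam\<close>, while \<open>u\<close>, \<open>u\<^sub>x\<close>, \<open>u\<^sub>x\<^sub>x\<close> stay arbitrary. There the terms of
  \<open>F\<^sup>*\<close> with \<open>\<phi>\<^sub>u u\<^sub>x\<close> cancel against those coming from \<open>\<phi>\<^sub>u u\<^sub>t\<close>, so \<open>p\<close> and \<open>q\<close> survive only in the
  third-order term.
\<close>

lemma determining_equation:
  assumes "smooth_on (UNIV \<times> I \<times> UNIV) \<phi>" and "t \<in> I"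
    and "\<And>u. adjoint_eq (gardner A B C Q) x t u (substituted_jet \<phi> x t u)
      = lam u * gardner A B C Q x t u"
  shows "lower_order_Dx3 \<phi> (x, t, y) p q * B t
    = Q t * y * d_u \<phi> (x, t, y) + Q t * \<phi> (x, t, y) - d_t \<phi> (x, t, y)
      - (A t * y + C t * y\<^sup>2) * d_x \<phi> (x, t, y)"
proof -
  define u :: jet where "u = (\<lambda>_. 0)((0, 0) := y, (1, 0) := p, (2, 0) := q,
    (0, 1) := - (A t * y * p + C t * y\<^sup>2 * p + Q t * y))"
  have u: "u (0, 0) = y" "u (1, 0) = p" "u (2, 0) = q" "u (3, 0) = 0"
    "u (0, 1) = - (A t * y * p + C t * y\<^sup>2 * p + Q t * y)"
    by (simp_all add: u_def)
  have "gardner A B C Q x t u = 0"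
    unfolding gardner_def u by simp
  with assms(3)[of u] have "adjoint_eq (gardner A B C Q) x t u (substituted_jet \<phi> x t u) = 0"
    by simp
  then show ?thesis
    unfolding adjoint_eq_gardner substituted_jet_00 substituted_jet_01[OF assms(1,2)]
      substituted_jet_10[OF assms(1,2)] substituted_jet_30[OF assms(1,2)] u
    by (simp add: algebra_simps)
qed

text \<open>
  The right-hand side of the determining equation is free of \<open>p\<close> and \<open>q\<close>, and \<open>B \<noteq> 0\<close>, so
  \<open>lower_order_Dx3\<close> is constant in \<open>p\<close> and \<open>q\<close>. Its coefficients are read off by differencing over
  values 0 and 1 of \<open>p\<close> and \<open>q\<close>.
\<close>

lemma self_adjoint_substitution_imp_exponential_form:
  assumes "open I" and "convex I" and "self_adjoint_substitution I (gardner A B C Q) \<phi>"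
    and "\<And>t. t \<in> I \<Longrightarrow> B t \<noteq> 0"
    and "\<And>t. t \<in> I \<Longrightarrow> C t \<noteq> 0"
    and "\<And>t. t \<in> I \<Longrightarrow> (intQ has_real_derivative Q t) (at t)"
    and "\<And>t. t \<in> I \<Longrightarrow> (int2Q has_real_derivative 2 * Q t) (at t)"
  shows "\<exists>c\<^sub>1 c\<^sub>2. \<forall>x. \<forall>t\<in>I. \<forall>y.
    \<phi> (x, t, y) = c\<^sub>1 * exp (int2Q t) * y + c\<^sub>2 * exp (intQ t)"
proof -
  from assms(3) obtain lam where smooth: "smooth_on (UNIV \<times> I \<times> UNIV) \<phi>"
    and eq: "\<And>x t u. t \<in> I \<Longrightarrow>
      adjoint_eq (gardner A B C Q) x t u (substituted_jet \<phi> x t u) = lam x t u * gardner A B C Q x t u"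
    unfolding self_adjoint_substitution_def by blast
  note smooth_intros = smooth_on_d_x smooth_on_d_u smooth
  note det = determining_equation[OF smooth _ eq]
  note det_div = eq_divide_imp[OF assms(4) det]
  (* The mixed second difference over p, q in {0, 1} isolates the coefficient of p * q. *)
  have uu: "d_u (d_u \<phi>) (x, t, y) = 0" if "t \<in> I" for x t y
    using det_div[OF that that that, of x y 1 1] det_div[OF that that that, of x y 1 0]
      det_div[OF that that that, of x y 0 1] det_div[OF that that that, of x y 0 0]
    by (simp add: lower_order_Dx3_def)
  have xu: "2 * d_x (d_u \<phi>) (x, t, y) + d_u (d_x \<phi>) (x, t, y) = 0" if "t \<in> I" for x t y
    using det_div[OF that that that, of x y 0 1] det_div[OF that that that, of x y 0 0]
    by (simp add: lower_order_Dx3_def)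
  have d_u_const: "d_u \<phi> (x, t, y) = d_u \<phi> (x, t, 0)" if "t \<in> I" for x t y
    using has_derivative_d_u[OF smooth_on_d_u[OF smooth] that] uu[OF that]
    by (intro DERIV_isconst_all[where f = "\<lambda>y. d_u \<phi> (x, t, y)"]) simp
  have affine: "\<phi> (x, t, y) = \<phi> (x, t, 0) + y * d_u \<phi> (x, t, 0)" if "t \<in> I" for x t y
  proof -
    have "((\<lambda>y. \<phi> (x, t, y) - y * d_u \<phi> (x, t, 0)) has_real_derivative 0) (at y)" for y
      using d_u_const[OF that, of x y]
      by (auto intro!: derivative_eq_intros has_derivative_d_u[OF smooth that])
    then have "\<phi> (x, t, y) - y * d_u \<phi> (x, t, 0) = \<phi> (x, t, 0) - 0 * d_u \<phi> (x, t, 0)"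
      by (intro DERIV_isconst_all[where f = "\<lambda>y. \<phi> (x, t, y) - y * d_u \<phi> (x, t, 0)"]) blast
    then show ?thesis by simp
  qed
  have d_x_affine: "d_x \<phi> (x, t, y) = d_x \<phi> (x, t, 0) + y * d_x (d_u \<phi>) (x, t, 0)"
    if "t \<in> I" for x t y
  proof (rule DERIV_unique)
    show "((\<lambda>x. \<phi> (x, t, y)) has_real_derivative d_x \<phi> (x, t, y)) (at x)"
      by (rule has_derivative_d_x[OF smooth that])
    show "((\<lambda>x. \<phi> (x, t, y)) has_real_derivative
        d_x \<phi> (x, t, 0) + y * d_x (d_u \<phi>) (x, t, 0)) (at x)"
      unfolding affine[OF that, of _ y]
      by (auto intro!: derivative_eq_intros has_derivative_d_x[OF _ that] smooth_intros)
  qed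
  (* Affinity in u makes the two mixed partial derivatives agree, so xu says that both vanish. *)
  have xu_0: "d_x (d_u \<phi>) (x, t, 0) = 0" if "t \<in> I" for x t
  proof -
    have "(\<lambda>y. d_x \<phi> (x, t, y)) = (\<lambda>y. d_x \<phi> (x, t, 0) + y * d_x (d_u \<phi>) (x, t, 0))"
      using d_x_affine[OF that, of x] by blast
    then have "((\<lambda>y. d_x \<phi> (x, t, y)) has_real_derivative d_x (d_u \<phi>) (x, t, 0)) (at 0)"
      by (auto intro!: derivative_eq_intros)
    then have "d_u (d_x \<phi>) (x, t, 0) = d_x (d_u \<phi>) (x, t, 0)"
      by (rule DERIV_unique[OF has_derivative_d_u[OF smooth_on_d_x[OF smooth] that]])
    with xu[OF that, of x 0] show ?thesis by simp
  qed
  have x_const: "d_x \<phi> (x, t, y) = d_x \<phi> (x, t, 0)" if "t \<in> I" for x t y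
    using d_x_affine[OF that, of x y] xu_0[OF that] by simp
  have xx_const: "d_x (d_x \<phi>) (x, t, y) = d_x (d_x \<phi>) (x, t, 0)" if "t \<in> I" for x t y
    using has_derivative_d_x[OF smooth_on_d_x[OF smooth] that, of y x]
    unfolding x_const[OF that, of _ y]
    by (rule DERIV_unique) (intro has_derivative_d_x[OF _ that] smooth_intros)
  have xxx_const: "d_x (d_x (d_x \<phi>)) (x, t, y) = d_x (d_x (d_x \<phi>)) (x, t, 0)"
    if "t \<in> I" for x t y
    using has_derivative_d_x[OF smooth_on_d_x[OF smooth_on_d_x[OF smooth]] that, of y x]
    unfolding xx_const[OF that, of _ y]
    by (rule DERIV_unique) (intro has_derivative_d_x[OF _ that] smooth_intros)
  have t_affine: "d_t \<phi> (x, t, y) = d_t \<phi> (x, t, 0) + y * d_t (d_u \<phi>) (x, t, 0)"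
    if "t \<in> I" for x t y
  proof (rule DERIV_unique)
    show "((\<lambda>s. \<phi> (x, s, y)) has_real_derivative d_t \<phi> (x, t, y)) (at t)"
      by (rule has_derivative_d_t[OF smooth that])
    have "((\<lambda>s. \<phi> (x, s, 0) + y * d_u \<phi> (x, s, 0)) has_real_derivative
        d_t \<phi> (x, t, 0) + y * d_t (d_u \<phi>) (x, t, 0)) (at t)"
      by (auto intro!: derivative_eq_intros has_derivative_d_t[OF _ that] smooth_intros)
    then show "((\<lambda>s. \<phi> (x, s, y)) has_real_derivative
        d_t \<phi> (x, t, 0) + y * d_t (d_u \<phi>) (x, t, 0)) (at t)"
      by (rule has_field_derivative_transform_within_open[OF _ assms(1) that]) (metis affine)
  qed
  (* phi, phi_t and phi_x are now explicit polynomials in u, so the determining equation at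
     p = q = 0 is an identity between polynomials of degree 2 in u. *)
  have reduced: "B t * d_x (d_x (d_x \<phi>)) (x, t, 0)
      = Q t * \<phi> (x, t, 0) - d_t \<phi> (x, t, 0)
        + y * (2 * Q t * d_u \<phi> (x, t, 0) - d_t (d_u \<phi>) (x, t, 0) - A t * d_x \<phi> (x, t, 0))
        - y\<^sup>2 * (C t * d_x \<phi> (x, t, 0))" if "t \<in> I" for x t y
    using det[OF that that, of x y 0 0] affine[OF that, of x y] d_u_const[OF that, of x y]
      t_affine[OF that, of x y] x_const[OF that, of x y] xxx_const[OF that, of x y]
    by (simp add: lower_order_Dx3_def algebra_simps)
  have x_zero: "d_x \<phi> (x, t, y) = 0" if "t \<in> I" for x t y
  proof -
    (* The second difference over u = -1, 0, 1 isolates the coefficient of u^2. *)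
    have "C t * d_x \<phi> (x, t, 0) = 0"
      using reduced[OF that, of x 0] reduced[OF that, of x 1] reduced[OF that, of x "- 1"]
      unfolding power2_eq_square by linarith
    with assms(5)[OF that] x_const[OF that, of x y] show ?thesis by simp
  qed
  have xxx_zero: "d_x (d_x (d_x \<phi>)) (x, t, 0) = 0" if "t \<in> I" for x t
  proof -
    have "d_x (d_x \<phi>) (s, t, 0) = 0" for s
      by (rule d_x_eq_0[OF smooth_on_d_x[OF smooth] that]) (rule x_zero[OF that])
    then show ?thesis
      by (rule d_x_eq_0[OF smooth_on_d_x[OF smooth_on_d_x[OF smooth]] that])
  qed
  have phi_t: "d_t \<phi> (x, t, 0) = Q t * \<phi> (x, t, 0)" if "t \<in> I" for x t
    using reduced[OF that, of x 0] xxx_zero[OF that, of x] by simp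
  have u_t: "d_t (d_u \<phi>) (x, t, 0) = 2 * Q t * d_u \<phi> (x, t, 0)" if "t \<in> I" for x t
    using reduced[OF that, of x 0] reduced[OF that, of x 1] x_zero[OF that, of x 0] by simp
  have "((\<lambda>s. \<phi> (0, s, 0)) has_real_derivative Q t * \<phi> (0, t, 0)) (at t)" if "t \<in> I" for t
    unfolding phi_t[OF that, symmetric] by (rule has_derivative_d_t[OF smooth that])
  from linear_ode_solution[OF assms(2) this assms(6)]
  obtain c\<^sub>2 where c2: "\<And>t. t \<in> I \<Longrightarrow> \<phi> (0, t, 0) = c\<^sub>2 * exp (intQ t)" by blast
  have "((\<lambda>s. d_u \<phi> (0, s, 0)) has_real_derivative 2 * Q t * d_u \<phi> (0, t, 0)) (at t)"
    if "t \<in> I" for t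
    unfolding u_t[OF that, symmetric] by (rule has_derivative_d_t[OF smooth_on_d_u[OF smooth] that])
  from linear_ode_solution[OF assms(2) this assms(7)]
  obtain c\<^sub>1 where c1: "\<And>t. t \<in> I \<Longrightarrow> d_u \<phi> (0, t, 0) = c\<^sub>1 * exp (int2Q t)" by blast
  show ?thesis
  proof (intro exI allI ballI)
    fix x t y assume "t \<in> I"
    have "\<phi> (x, t, y) = \<phi> (0, t, y)"
      using has_derivative_d_x[OF smooth \<open>t \<in> I\<close>] x_zero[OF \<open>t \<in> I\<close>]
      by (intro DERIV_isconst_all[where f = "\<lambda>x. \<phi> (x, t, y)"]) simp
    then show "\<phi> (x, t, y) = c\<^sub>1 * exp (int2Q t) * y + c\<^sub>2 * exp (intQ t)"
      using affine[OF \<open>t \<in> I\<close>, of 0 y] c1[OF \<open>t \<in> I\<close>] c2[OF \<open>t \<in> I\<close>] by simp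
  qed
qed

section \<open>The exponential substitutions\<close>

text \<open>
  Since \<open>\<phi>\<^sub>x = 0\<close> and \<open>\<phi>\<^sub>u\<close> depends on \<open>t\<close> alone, \<open>D\<^sub>x\<^sup>3 \<phi> = \<phi>\<^sub>u u\<^sub>x\<^sub>x\<^sub>x\<close>, and
  \<open>F\<^sup>*\<close> becomes \<open>- \<phi>\<^sub>u F\<close>; the factor 2 in the exponent of the first term supplies the term
  \<open>Q u\<close> of \<open>F\<close>, and the second term contributes \<open>- \<phi>\<^sub>t + Q \<phi> = 0\<close>.
\<close>

lemma exponential_form_imp_self_adjoint_substitution:
  assumes "open I" and "I \<noteq> {}" and "smooth_on I Q"
    and "\<And>t. t \<in> I \<Longrightarrow> (intQ has_real_derivative Q t) (at t)"
    and "\<And>t. t \<in> I \<Longrightarrow> (int2Q has_real_derivative 2 * Q t) (at t)"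
    and "\<not> (c\<^sub>1 = 0 \<and> c\<^sub>2 = 0)"
    and form: "\<And>(x::real) t y. t \<in> I \<Longrightarrow>
      \<phi> (x, t, y) = c\<^sub>1 * exp (int2Q t) * y + c\<^sub>2 * exp (intQ t)"
  shows "self_adjoint_substitution I (gardner A B C Q) \<phi>"
proof -
  let ?S = "UNIV \<times> I \<times> UNIV :: (real \<times> real \<times> real) set"
  have "open ?S" using assms(1) by (intro open_Times) auto
  have smooth: "smooth_on ?S \<phi>"
    unfolding smooth_on_def
  proof
    fix k
    have "smooth_on I (\<lambda>t. 2 * Q t)"
      using assms(3) unfolding smooth_on_def by (intro allI Ck_on_mult assms(1) Ck_on_const) blast
    then have exp1: "smooth_on I (\<lambda>t. exp (int2Q t))"
      by (rule smooth_on_exp_antiderivative[OF assms(1)]) (rule assms(5))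
    have exp2: "smooth_on I (\<lambda>t. exp (intQ t))"
      by (rule smooth_on_exp_antiderivative[OF assms(1,3)]) (rule assms(4))
    have pull_back: "Ck_on k ?S (\<lambda>p. h (fst (snd p)))" if "smooth_on I h" for h :: "real \<Rightarrow> real"
      by (rule Ck_on_compose_linear[where S = I and L = "\<lambda>p. fst (snd p)"])
        (use that \<open>open ?S\<close> assms(1) in
          \<open>auto simp: smooth_on_def intro: bounded_linear_fst_comp bounded_linear_snd\<close>)
    have "Ck_on k ?S (\<lambda>p. c\<^sub>1 * exp (int2Q (fst (snd p))) * snd (snd p) + c\<^sub>2 * exp (intQ (fst (snd p))))"
      by (intro Ck_on_add Ck_on_mult Ck_on_const \<open>open ?S\<close> pull_back[OF exp1] pull_back[OF exp2]
          Ck_on_linear[OF bounded_linear_snd_comp[OF bounded_linear_snd]])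
    then show "Ck_on k ?S \<phi>"
      by (rule Ck_on_cong[OF \<open>open ?S\<close>, rotated]) (auto simp: form)
  qed
  have u: "d_u \<phi> (x, t, y) = c\<^sub>1 * exp (int2Q t)" if "t \<in> I" for x t y
    by (rule DERIV_unique[OF has_derivative_d_u[OF smooth that]])
      (auto simp: form[OF that] intro!: derivative_eq_intros)
  have x: "d_x \<phi> (x, t, y) = 0" if "t \<in> I" for x t y
    by (rule DERIV_unique[OF has_derivative_d_x[OF smooth that]])
      (auto simp: form[OF that] intro!: derivative_eq_intros)
  have t: "d_t \<phi> (x, t, y) = 2 * Q t * c\<^sub>1 * exp (int2Q t) * y + Q t * c\<^sub>2 * exp (intQ t)"
    if "t \<in> I" for x t y
  proof (rule DERIV_unique[OF has_derivative_d_t[OF smooth that]])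
    have "((\<lambda>s. c\<^sub>1 * exp (int2Q s) * y + c\<^sub>2 * exp (intQ s)) has_real_derivative
        2 * Q t * c\<^sub>1 * exp (int2Q t) * y + Q t * c\<^sub>2 * exp (intQ t)) (at t)"
      by (auto intro!: derivative_eq_intros assms(4,5) that)
    then show "((\<lambda>s. \<phi> (x, s, y)) has_real_derivative
        2 * Q t * c\<^sub>1 * exp (int2Q t) * y + Q t * c\<^sub>2 * exp (intQ t)) (at t)"
      by (rule has_field_derivative_transform_within_open[OF _ assms(1) that]) (simp add: form)
  qed
  have second: "d_x (d_x \<phi>) (x, t, y) = 0" "d_u (d_x \<phi>) (x, t, y) = 0"
    "d_x (d_u \<phi>) (x, t, y) = 0" "d_u (d_u \<phi>) (x, t, y) = 0" if "t \<in> I" for x t y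
    by (rule d_x_eq_0[OF smooth_on_d_x[OF smooth] that, OF x[OF that]]
        d_u_eq_0[OF smooth_on_d_x[OF smooth] that, OF x[OF that]]
        d_x_eq_0[OF smooth_on_d_u[OF smooth] that, OF u[OF that]]
        d_u_eq_0[OF smooth_on_d_u[OF smooth] that, OF u[OF that]])+
  have third: "d_x f (x, t, y) = 0" "d_u f (x, t, y) = 0"
    if "t \<in> I" and "f \<in> {d_x (d_x \<phi>), d_u (d_x \<phi>), d_x (d_u \<phi>), d_u (d_u \<phi>)}" for f x t y
  proof -
    have "smooth_on ?S f" using that(2) by (auto intro: smooth_on_d_x smooth_on_d_u smooth)
    moreover have "f (r, t, s) = 0" for r s using that second[OF that(1)] by auto
    ultimately show "d_x f (x, t, y) = 0" "d_u f (x, t, y) = 0"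
      using that(1) by (auto intro: d_x_eq_0 d_u_eq_0)
  qed
  have jet_30: "substituted_jet \<phi> x t u (3, 0) = u (3, 0) * c\<^sub>1 * exp (int2Q t)" if "t \<in> I" for x t u
    unfolding substituted_jet_30[OF smooth that]
    by (simp add: lower_order_Dx3_def u[OF that] second[OF that] third[OF that])
  (* The multiplier must be - phi_u, as comparing the coefficients of u_t shows. *)
  define lam :: jfun where "lam = (\<lambda>x t u. - c\<^sub>1 * exp (int2Q t))"
  have "adjoint_eq (gardner A B C Q) x t u (substituted_jet \<phi> x t u)
      = lam x t u * gardner A B C Q x t u" if "t \<in> I" for x t u
    unfolding adjoint_eq_gardner jet_30[OF that] substituted_jet_00
      substituted_jet_10[OF smooth that] substituted_jet_01[OF smooth that]
    by (simp add: u[OF that] x[OF that] t[OF that] form[OF that] lam_def gardner_def algebra_simps)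
  moreover have "differential_function lam"
    by (simp add: differential_function_def lam_def)
  moreover have "\<exists>x. \<exists>t\<in>I. \<exists>y. \<phi> (x, t, y) \<noteq> 0"
  proof -
    obtain t where "t \<in> I" using assms(2) by blast
    have "\<phi> (0, t, 0) \<noteq> 0 \<or> \<phi> (0, t, 1) \<noteq> 0"
      using assms(6) by (auto simp: form[OF \<open>t \<in> I\<close>])
    with \<open>t \<in> I\<close> show ?thesis by blast
  qed
  ultimately show ?thesis using smooth unfolding self_adjoint_substitution_def by blast
qed

section \<open>Nonlinear self-adjointness of the Gardner equation\<close>

theorem theorem2:
  fixes I :: "real set"
    and A B C Q intQ int2Q :: "real \<Rightarrow> real"
  assumes "open I" and "is_interval I" and "I \<noteq> {}"
    and "smooth_on I A" and "smooth_on I B" and "smooth_on I C" and "smooth_on I Q"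
    and "\<And>t. t \<in> I \<Longrightarrow> A t \<noteq> 0"
    and "\<And>t. t \<in> I \<Longrightarrow> B t \<noteq> 0"
    and "\<And>t. t \<in> I \<Longrightarrow> C t \<noteq> 0"
    and "\<And>t. t \<in> I \<Longrightarrow> (intQ has_real_derivative Q t) (at t)"
    and "\<And>t. t \<in> I \<Longrightarrow> (int2Q has_real_derivative 2 * Q t) (at t)"
  shows "nonlinearly_self_adjoint I (gardner A B C Q) \<and>
    (\<forall>\<phi>. self_adjoint_substitution I (gardner A B C Q) \<phi> \<longleftrightarrow>
       (\<exists>c\<^sub>1 c\<^sub>2 :: real. \<not> (c\<^sub>1 = 0 \<and> c\<^sub>2 = 0) \<and>
          (\<forall>x. \<forall>t\<in>I. \<forall>u. \<phi> (x, t, u) = c\<^sub>1 * exp (int2Q t) * u + c\<^sub>2 * exp (intQ t))))"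
proof (rule conjI)
  have sufficient: "self_adjoint_substitution I (gardner A B C Q) \<phi>"
    if "\<not> (c\<^sub>1 = 0 \<and> c\<^sub>2 = 0)"
      and "\<forall>x. \<forall>t\<in>I. \<forall>u. \<phi> (x, t, u) = c\<^sub>1 * exp (int2Q t) * u + c\<^sub>2 * exp (intQ t)" for \<phi> c\<^sub>1 c\<^sub>2
  proof (rule exponential_form_imp_self_adjoint_substitution[OF assms(1,3,7) _ _ that(1)])
    show "\<phi> (x, t, y) = c\<^sub>1 * exp (int2Q t) * y + c\<^sub>2 * exp (intQ t)" if "t \<in> I" for x t y
      using \<open>\<forall>x. \<forall>t\<in>I. \<forall>u. \<phi> (x, t, u) = c\<^sub>1 * exp (int2Q t) * u + c\<^sub>2 * exp (intQ t)\<close> that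
      by blast
  qed (rule assms(11,12), assumption)+
  have "self_adjoint_substitution I (gardner A B C Q) (\<lambda>(x, t, u). 1 * exp (int2Q t) * u + 0 * exp (intQ t))"
    by (rule sufficient[of 1 0]) simp_all
  then show "nonlinearly_self_adjoint I (gardner A B C Q)"
    unfolding nonlinearly_self_adjoint_def by blast
  show "\<forall>\<phi>. self_adjoint_substitution I (gardner A B C Q) \<phi> \<longleftrightarrow>
       (\<exists>c\<^sub>1 c\<^sub>2 :: real. \<not> (c\<^sub>1 = 0 \<and> c\<^sub>2 = 0) \<and>
          (\<forall>x. \<forall>t\<in>I. \<forall>u. \<phi> (x, t, u) = c\<^sub>1 * exp (int2Q t) * u + c\<^sub>2 * exp (intQ t)))"
  proof (intro allI iffI)
    fix \<phi> :: "real \<times> real \<times> real \<Rightarrow> real"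
    assume *: "self_adjoint_substitution I (gardner A B C Q) \<phi>"
    have "convex I" using assms(2) by (rule is_interval_convex)
    obtain c\<^sub>1 c\<^sub>2 where form:
      "\<And>x t y. t \<in> I \<Longrightarrow> \<phi> (x, t, y) = c\<^sub>1 * exp (int2Q t) * y + c\<^sub>2 * exp (intQ t)"
      using self_adjoint_substitution_imp_exponential_form[OF \<open>open I\<close> \<open>convex I\<close> * assms(9,10,11,12)]
      by blast
    moreover have "\<not> (c\<^sub>1 = 0 \<and> c\<^sub>2 = 0)"
      using * unfolding self_adjoint_substitution_def by (auto simp: form)
    ultimately show "\<exists>c\<^sub>1 c\<^sub>2 :: real. \<not> (c\<^sub>1 = 0 \<and> c\<^sub>2 = 0) \<and>
          (\<forall>x. \<forall>t\<in>I. \<forall>u. \<phi> (x, t, u) = c\<^sub>1 * exp (int2Q t) * u + c\<^sub>2 * exp (intQ t))"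
      by blast
  next
    fix \<phi> :: "real \<times> real \<times> real \<Rightarrow> real"
    assume "\<exists>c\<^sub>1 c\<^sub>2 :: real. \<not> (c\<^sub>1 = 0 \<and> c\<^sub>2 = 0) \<and>
          (\<forall>x. \<forall>t\<in>I. \<forall>u. \<phi> (x, t, u) = c\<^sub>1 * exp (int2Q t) * u + c\<^sub>2 * exp (intQ t))"
    then show "self_adjoint_substitution I (gardner A B C Q) \<phi>"
      by (elim exE conjE) (rule sufficient)
  qed
qed

end
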